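(* Let $p$ be an odd rational prime, $\zeta$ a primitive $p$-th root of unity, $K=\mathbb{Q}(\zeta)$ with ring of algebraic integers $O_{K}=\mathbb{Z}[\zeta]$, and let $\sigma,\tau$ be any two different non-zero ring endomorphisms of $O_{K}$. Then the $\mathbb{Z}$-module $\mathcal{D}_{(\sigma,\tau)}(O_{K})$ is finitely generated of rank $p-1$.
   Context: $\mathcal{D}_{(\sigma,\tau)}(O_{K})$ is the $\mathbb{Z}$-module (under pointwise operations) of all $(\sigma,\tau)$-derivations of $O_{K}$, i.e. of all $\mathbb{Z}$-linear maps $D:O_{K}\to O_{K}$ with $D(xy)=D(x)\tau(y)+\sigma(x)D(y)$ for all $x,y\in O_{K}$. *)

theory Defs
  imports
    Complex_Main
    "HOL-Library.FuncSet"
    "HOL-Library.Function_Algebras"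
    "HOL-Computational_Algebra.Computational_Algebra"
begin

section \<open>Number fields and their rings of integers\<close>

definition primitive_root_of_unity :: "nat \<Rightarrow> 'a::field \<Rightarrow> bool" where
  "primitive_root_of_unity n z \<longleftrightarrow>
     0 < n \<and> z ^ n = 1 \<and> (\<forall>k. 0 < k \<and> k < n \<longrightarrow> z ^ k \<noteq> 1)"

definition is_subfield :: "'a::field set \<Rightarrow> bool" where
  "is_subfield F \<longleftrightarrow>
     0 \<in> F \<and> 1 \<in> F \<and>
     (\<forall>x\<in>F. \<forall>y\<in>F. x + y \<in> F) \<and> (\<forall>x\<in>F. - x \<in> F) \<and>
     (\<forall>x\<in>F. \<forall>y\<in>F. x * y \<in> F) \<and> (\<forall>x\<in>F. inverse x \<in> F)"

text \<open>The smallest subfield containing \<open>z\<close>.  In characteristic zero every subfield contains the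
  rationals, so this is \<open>\<rat>(z)\<close>.\<close>

definition rat_adjoin :: "'a::field_char_0 \<Rightarrow> 'a set" where
  "rat_adjoin z = is_subfield hull {z}"

definition ring_of_integers :: "'a::field_char_0 set \<Rightarrow> 'a set" where
  "ring_of_integers K = {x \<in> K. algebraic_int x}"


section \<open>Twisted derivations\<close>

text \<open>Ring endomorphisms are not required to preserve \<open>1\<close>, so that the zero map is one.
  Only the values on \<open>R\<close> matter.\<close>

definition ring_endo_on :: "'a::ring_1 set \<Rightarrow> ('a \<Rightarrow> 'a) \<Rightarrow> bool" where
  "ring_endo_on R f \<longleftrightarrow>
     f \<in> R \<rightarrow> R \<and>
     (\<forall>x\<in>R. \<forall>y\<in>R. f (x + y) = f x + f y) \<and>
     (\<forall>x\<in>R. \<forall>y\<in>R. f (x * y) = f x * f y)"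

text \<open>A map \<open>R \<rightarrow> R\<close> is represented by its extension by \<open>0\<close> to the whole type.  This makes the
  representation unique and compatible with the pointwise operations.\<close>

definition twisted_derivations ::
    "'a::ring_1 set \<Rightarrow> ('a \<Rightarrow> 'a) \<Rightarrow> ('a \<Rightarrow> 'a) \<Rightarrow> ('a \<Rightarrow> 'a) set" where
  "twisted_derivations R \<sigma> \<tau> =
     {D. D \<in> R \<rightarrow> R \<and> (\<forall>x. x \<notin> R \<longrightarrow> D x = 0) \<and>
         (\<forall>x\<in>R. \<forall>y\<in>R. D (x + y) = D x + D y) \<and>
         (\<forall>n::int. \<forall>x\<in>R. D (of_int n * x) = of_int n * D x) \<and>
         (\<forall>x\<in>R. \<forall>y\<in>R. D (x * y) = D x * \<tau> y + \<sigma> x * D y)}"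


section \<open>Finite generation and rank\<close>

context module
begin

definition finitely_generated :: "'b set \<Rightarrow> bool" where
  "finitely_generated M \<longleftrightarrow> (\<exists>S. finite S \<and> S \<subseteq> M \<and> span S = M)"

text \<open>The rank is the maximal cardinality of a linearly independent subset.\<close>

definition has_rank :: "'b set \<Rightarrow> nat \<Rightarrow> bool" where
  "has_rank M r \<longleftrightarrow>
     (\<exists>B\<subseteq>M. independent B \<and> finite B \<and> card B = r) \<and>
     (\<forall>B\<subseteq>M. independent B \<longrightarrow> finite B \<and> card B \<le> r)"

end

definition int_scale :: "int \<Rightarrow> ('b \<Rightarrow> 'a::ring_1) \<Rightarrow> 'b \<Rightarrow> 'a" where
  "int_scale n f = (\<lambda>x. of_int n * f x)"

global_interpretation int_fun: module "int_scale :: int \<Rightarrow> ('b \<Rightarrow> 'a::ring_1) \<Rightarrow> 'b \<Rightarrow> 'a"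
  by unfold_locales (simp_all add: int_scale_def fun_eq_iff algebra_simps)

lemma subspace_twisted_derivations:
  fixes R :: "'a::comm_ring_1 set"
  assumes "0 \<in> R" "\<And>x y. x \<in> R \<Longrightarrow> y \<in> R \<Longrightarrow> x + y \<in> R"
    and "\<And>n x. x \<in> R \<Longrightarrow> of_int n * x \<in> R"
  shows "int_fun.subspace (twisted_derivations R \<sigma> \<tau>)"
proof -
  have "x * of_int n \<in> R" if "x \<in> R" for n x
    using assms(3)[OF that, of n] by (simp add: mult.commute)
  with assms show ?thesis
    unfolding int_fun.subspace_def
    by (auto simp: twisted_derivations_def int_scale_def Pi_iff algebra_simps)
qed

end

(*
For every (\<sigma>, \<tau>)-derivation D, commutativity gives D x (\<tau> y - \<sigma> y) = D y (\<tau> x - \<sigma> x).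
Fixing y with \<sigma> y \<noteq> \<tau> y, the Z-linear map D \<mapsto> D y is therefore injective into the ring of
integers.  The latter lies in 1/p Z[\<zeta>]: the coefficients of an integral element are, up to the
factor p, traces of algebraic integers.  So the derivations embed into Z^(p - 1), which gives finite
generation and the upper bound for the rank.  The derivations \<zeta>^i (\<tau> - \<sigma>) with i < p - 1 are
independent, because 1, \<zeta>, ..., \<zeta>^(p - 2) are.
*)

theory Submission
  imports Defs "Jordan_Normal_Form.Char_Poly" "HOL-Computational_Algebra.Field_as_Ring"
begin

unbundle no fps_syntax

section \<open>Algebraic integers\<close>

text \<open>Independence of the powers of \<zeta> is the irreducibility of the p-th cyclotomic
  polynomial in disguise. It rests on the total ramification of p: \<theta> = \<zeta> - 1 satisfies
  \<theta>^(p - 1) = - p (1 + \<theta> s) with an algebraic integer s, and an integer relation of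
  smaller degree between powers of \<theta> then has all its coefficients divisible by p. The same
  irreducibility lets substitution replace field automorphisms: a conjugate of f(\<zeta>) is f(z)
  for a p-th root of unity z \<noteq> 1, and a trace is a sum of such values. Both arguments end
  with a rational algebraic integer being an integer, which is why algebraic integers must be closed
  under sums and products. Evaluation at y need not be onto, and the derivations \<zeta>^i (\<tau> -
  \<sigma>) need not generate. Hence the generators come from an abstract statement about subgroups
  of Z^n, while the explicit derivations serve only as a lower bound for the rank.\<close>

interpretation int_mult: Modules.module "\<lambda>n (x::'a::comm_ring_1). of_int n * x"
  by unfold_locales (simp_all add: algebra_simps)

text \<open>Determinant trick: multiplication by \<open>x\<close> acts on the generators through an
  integer matrix, the generators form an eigenvector of it with eigenvalue \<open>x\<close>, and the
  characteristic polynomial is monic with integer coefficients. The generator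
  \<open>s\<^sub>0\<close> makes the eigenvector nonzero.\<close>

lemma algebraic_int_if_stable_span:
  fixes x :: "'a::field_char_0"
  assumes "finite S" "s\<^sub>0 \<in> S" "s\<^sub>0 \<noteq> 0"
    and stable: "\<And>s. s \<in> S \<Longrightarrow> x * s \<in> int_mult.span S"
  shows "algebraic_int x"
proof -
  obtain h where h: "bij_betw h {0..<card S} S"
    using ex_bij_betw_nat_finite[OF \<open>finite S\<close>] by blast
  define n where "n = card S"
  have "\<forall>s\<in>S. \<exists>c. x * s = (\<Sum>t\<in>S. of_int (c t) * t)"
    using stable int_mult.span_finite[OF \<open>finite S\<close>] by auto
  then obtain C where C: "\<And>s. s \<in> S \<Longrightarrow> x * s = (\<Sum>t\<in>S. of_int (C s t) * t)"
    by metis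
  define A where "A = mat n n (\<lambda>(i, j). C (h i) (h j))"
  define B :: "'a mat" where "B = map_mat of_int A"
  have A: "A \<in> carrier_mat n n" and B: "B \<in> carrier_mat n n"
    by (simp_all add: A_def B_def)
  have hS: "h i \<in> S" if "i < n" for i
    using h that by (auto simp: bij_betw_def n_def)
  have "B *\<^sub>v vec n h = x \<cdot>\<^sub>v vec n h"
  proof (rule eq_vecI)
    fix i assume "i < dim_vec (x \<cdot>\<^sub>v vec n h)"
    then have i: "i < n" by simp
    have "(B *\<^sub>v vec n h) $ i = (\<Sum>j\<in>{0..<n}. of_int (C (h i) (h j)) * h j)"
      using i by (simp add: B_def A_def scalar_prod_def)
    also have "\<dots> = (\<Sum>t\<in>S. of_int (C (h i) t) * t)"
      using h by (intro sum.reindex_bij_betw) (simp add: n_def)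
    finally show "(B *\<^sub>v vec n h) $ i = (x \<cdot>\<^sub>v vec n h) $ i"
      using C[OF hS[OF i]] i by simp
  qed (use B in simp)
  moreover have "vec n h \<noteq> 0\<^sub>v n"
  proof -
    obtain i where "i < n" "h i = s\<^sub>0"
      using bij_betw_imp_surj_on[OF h] \<open>s\<^sub>0 \<in> S\<close> unfolding n_def by force
    then have "vec n h $ i \<noteq> 0\<^sub>v n $ i"
      using \<open>s\<^sub>0 \<noteq> 0\<close> by simp
    then show ?thesis by metis
  qed
  ultimately have "eigenvalue B x"
    using B unfolding eigenvalue_def eigenvector_def by (intro exI[of _ "vec n h"]) auto
  then have "poly (char_poly B) x = 0"
    using eigenvalue_root_char_poly[OF B] by simp
  then have "poly (map_poly of_int (char_poly A)) x = 0"
    unfolding B_def of_int_hom.char_poly_hom[OF A] .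
  then show ?thesis
    using degree_monic_char_poly[OF A] by (auto simp: algebraic_int_altdef_ipoly)
qed

lemma int_mult_span_mult:
  assumes "a \<in> int_mult.span S" "b \<in> int_mult.span T"
  shows "a * b \<in> int_mult.span {s * t |s t. s \<in> S \<and> t \<in> T}"
  using assms(1)
proof (induction rule: int_mult.span_induct_alt)
  case (step c s a)
  have "s * b \<in> int_mult.span {s * t |s t. s \<in> S \<and> t \<in> T}"
    using assms(2)
  proof (induction rule: int_mult.span_induct_alt)
    case (step d t b)
    then have "s * t \<in> int_mult.span {s * t |s t. s \<in> S \<and> t \<in> T}"
      using \<open>s \<in> S\<close> by (intro int_mult.span_base) auto
    from int_mult.span_add[OF int_mult.span_scale[OF this, of d] step(2)] show ?case
      by (simp add: algebra_simps)
  qed (simp add: int_mult.span_zero)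
  from int_mult.span_add[OF int_mult.span_scale[OF this, of c] step(2)] show ?case
    by (simp add: algebra_simps)
qed (simp add: int_mult.span_zero)

text \<open>A monic equation expresses its top power by the lower ones. \<open>m > 0\<close>
  guarantees that 1 is among these.\<close>

lemma algebraic_int_power_in_span:
  fixes x :: "'a::field_char_0"
  assumes "algebraic_int x"
  obtains m where "m > 0" "x ^ m \<in> int_mult.span ((\<lambda>i. x ^ i) ` {..<m})"
proof -
  obtain p where p: "poly (map_poly of_int p) x = 0" "lead_coeff p = 1"
    using assms by (auto simp: algebraic_int_altdef_ipoly)
  define m where "m = degree p"
  have eq: "(\<Sum>i<m. of_int (coeff p i) * x ^ i) + x ^ m = 0"
    using p by (simp add: poly_altdef m_def lessThan_Suc_atMost[symmetric])
  then have "m > 0"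
    by (cases m) auto
  have "x ^ m = (\<Sum>i<m. of_int (- coeff p i) * x ^ i)"
    using eq by (simp add: sum_negf add_eq_0_iff)
  also have "\<dots> \<in> int_mult.span ((\<lambda>i. x ^ i) ` {..<m})"
    by (intro int_mult.span_sum int_mult.span_scale int_mult.span_base) auto
  finally show thesis
    using that \<open>m > 0\<close> by blast
qed

text \<open>Multiplication by \<open>x\<close> and by \<open>y\<close> maps the span of the finitely
  many products x^i y^j with i < m and j < n to itself, hence so does multiplication by the sum and
  the product. The determinant trick applies to this common span.\<close>

lemma
  fixes x y :: "'a::field_char_0"
  assumes "algebraic_int x" "algebraic_int y"
  shows algebraic_int_add: "algebraic_int (x + y)"
    and algebraic_int_mult: "algebraic_int (x * y)"
proof -
  obtain m where m: "m > 0" "x ^ m \<in> int_mult.span ((\<lambda>i. x ^ i) ` {..<m})"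
    using algebraic_int_power_in_span assms by blast
  obtain n where n: "n > 0" "y ^ n \<in> int_mult.span ((\<lambda>i. y ^ i) ` {..<n})"
    using algebraic_int_power_in_span assms by blast
  define S where "S = {s * t |s t. s \<in> (\<lambda>i. x ^ i) ` {..<m} \<and> t \<in> (\<lambda>i. y ^ i) ` {..<n}}"
  have S_alt: "S = (\<lambda>(s, t). s * t) ` ((\<lambda>i. x ^ i) ` {..<m} \<times> (\<lambda>i. y ^ i) ` {..<n})"
    by (auto simp: S_def)
  have "finite S"
    unfolding S_alt by simp
  \<comment> \<open>The nonzero generator that the determinant trick asks for.\<close>
  have "x ^ 0 * y ^ 0 \<in> S"
    unfolding S_def using m n by blast
  then have "1 \<in> S"
    by simp
  have pow: "z ^ Suc i \<in> int_mult.span ((\<lambda>i. z ^ i) ` {..<k})"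
    if "i < k" "z ^ k \<in> int_mult.span ((\<lambda>i. z ^ i) ` {..<k})" for z :: 'a and i k
  proof (cases "Suc i = k")
    case False
    then have "Suc i < k" using that by simp
    then show ?thesis by (intro int_mult.span_base imageI) simp
  qed (use that in simp)
  have x: "x * s \<in> int_mult.span S" and y: "y * s \<in> int_mult.span S" if s: "s \<in> S" for s
  proof -
    obtain i j where ij: "i < m" "j < n" "s = x ^ i * y ^ j"
      using s by (auto simp: S_def)
    have "x ^ Suc i * y ^ j \<in> int_mult.span S"
      unfolding S_def using pow[OF ij(1) m(2)] ij
      by (intro int_mult_span_mult) (auto intro!: int_mult.span_base)
    then show "x * s \<in> int_mult.span S"
      using ij by (simp add: mult_ac)
    have "x ^ i * y ^ Suc j \<in> int_mult.span S"
      unfolding S_def using pow[OF ij(2) n(2)] ij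
      by (intro int_mult_span_mult) (auto intro!: int_mult.span_base)
    then show "y * s \<in> int_mult.span S"
      using ij by (simp add: mult_ac)
  qed
  have "x * w \<in> int_mult.span S" if "w \<in> int_mult.span S" for w
    using that
  proof (induction rule: int_mult.span_induct_alt)
    case (step c s w)
    then show ?case
      using int_mult.span_add[OF int_mult.span_scale[OF x, of s c], of "x * w"]
      by (simp add: algebra_simps)
  qed (simp add: int_mult.span_zero)
  then have "(x * y) * s \<in> int_mult.span S" if "s \<in> S" for s
    using y[OF that] by (simp add: mult.assoc)
  with \<open>finite S\<close> \<open>1 \<in> S\<close> show "algebraic_int (x * y)"
    by (intro algebraic_int_if_stable_span[of S 1]) auto
  have "(x + y) * s \<in> int_mult.span S" if "s \<in> S" for s
    using int_mult.span_add[OF x y, OF that that] by (simp add: algebra_simps)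
  with \<open>finite S\<close> \<open>1 \<in> S\<close> show "algebraic_int (x + y)"
    by (intro algebraic_int_if_stable_span[of S 1]) auto
qed

lemma algebraic_int_power:
  fixes x :: "'a::field_char_0"
  shows "algebraic_int x \<Longrightarrow> algebraic_int (x ^ n)"
  by (induction n) (auto intro: algebraic_int_mult)

lemma algebraic_int_sum:
  fixes f :: "'b \<Rightarrow> 'a::field_char_0"
  shows "(\<And>i. i \<in> I \<Longrightarrow> algebraic_int (f i)) \<Longrightarrow> algebraic_int (sum f I)"
  by (induction I rule: infinite_finite_induct) (auto intro: algebraic_int_add)

section \<open>Submodules of free modules over the integers\<close>

text \<open>Gaussian elimination without division: a pivot with nonzero last coordinate clears that
  coordinate from the other vectors, which still outnumber the remaining coordinates.\<close>

lemma nontrivial_integer_relation: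
  fixes v :: "'b \<Rightarrow> nat \<Rightarrow> int"
  assumes "finite B" "n < card B"
  shows "\<exists>c::'b \<Rightarrow> int. (\<exists>b\<in>B. c b \<noteq> 0) \<and> (\<forall>i<n. (\<Sum>b\<in>B. c b * v b i) = 0)"
  using assms
proof (induction n arbitrary: B v)
  case 0
  then obtain b where "b \<in> B"
    by (metis card.empty equals0I less_irrefl)
  then show ?case
    by (intro exI[of _ "\<lambda>_. 1"]) auto
next
  case (Suc n)
  show ?case
  proof (cases "\<forall>b\<in>B. v b n = 0")
    case True
    obtain c where "\<exists>b\<in>B. c b \<noteq> 0" "\<forall>i<n. (\<Sum>b\<in>B. c b * v b i) = 0"
      using Suc.IH[of B v] Suc.prems by auto
    with True show ?thesis
      by (intro exI[of _ c]) (auto simp: less_Suc_eq)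
  next
    case False
    then obtain b\<^sub>0 where b0: "b\<^sub>0 \<in> B" "v b\<^sub>0 n \<noteq> 0" by blast
    define B' where "B' = B - {b\<^sub>0}"
    have B': "finite B'" "b\<^sub>0 \<notin> B'" "B = insert b\<^sub>0 B'" "n < card B'"
      using Suc.prems b0 by (auto simp: B'_def)
    \<comment> \<open>Cross multiplication with the pivot keeps the entries integral and makes
      coordinate \<open>n\<close> vanish.\<close>
    define w where "w b i = v b\<^sub>0 n * v b i - v b n * v b\<^sub>0 i" for b i
    obtain c where c: "\<exists>b\<in>B'. c b \<noteq> 0" "\<And>i. i < n \<Longrightarrow> (\<Sum>b\<in>B'. c b * w b i) = 0"
      using Suc.IH[of B' w] B' by auto
    have cw: "(\<Sum>b\<in>B'. c b * w b i) = 0" if "i < Suc n" for i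
      using c(2) that by (cases "i = n") (auto simp: w_def mult.commute)
    \<comment> \<open>The pivot receives the total multiple of it that was subtracted in
      \<open>w\<close>.\<close>
    define c' where "c' b = (if b = b\<^sub>0 then - (\<Sum>b\<in>B'. c b * v b n) else v b\<^sub>0 n * c b)" for b
    have "(\<Sum>b\<in>B. c' b * v b i) = 0" if "i < Suc n" for i
    proof -
      have "(\<Sum>b\<in>B'. c' b * v b i) = (\<Sum>b\<in>B'. v b\<^sub>0 n * c b * v b i)"
        using B'(2) by (intro sum.cong) (auto simp: c'_def)
      then have "(\<Sum>b\<in>B. c' b * v b i) = (\<Sum>b\<in>B'. c b * w b i)"
        using B'(1,2) unfolding B'(3)
        by (simp add: c'_def w_def sum_subtractf sum_distrib_left algebra_simps)
      with cw[OF that] show ?thesis by simp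
    qed
    moreover have "\<exists>b\<in>B. c' b \<noteq> 0"
      using c(1) b0 B' by (auto simp: c'_def)
    ultimately show ?thesis by blast
  qed
qed

text \<open>The scalars are fixed to the integers because generators are found by division with
  remainder.\<close>

locale int_module = Modules.module scale
  for scale :: "int \<Rightarrow> 'b::ab_group_add \<Rightarrow> 'b" (infixr \<open>*s\<close> 75)
begin

text \<open>A subgroup of Z^n is finitely generated: the last coordinates form an ideal of Z,
  generated by a value of least nonzero absolute value, and induction handles the elements whose
  last coordinate is zero. Linearity of \<open>\<phi>\<close> is asked for on \<open>M\<close> only,
  since the coordinates used later are floors whose additivity is established only for elements of
  the ring of integers.\<close>

lemma finitely_generated_if_coordinates:
  fixes \<phi> :: "'b \<Rightarrow> nat \<Rightarrow> int"
  assumes "subspace M"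
    and "\<And>x y i. x \<in> M \<Longrightarrow> y \<in> M \<Longrightarrow> \<phi> (x + y) i = \<phi> x i + \<phi> y i"
    and "\<And>c x i. x \<in> M \<Longrightarrow> \<phi> (c *s x) i = c * \<phi> x i"
    and "\<And>x. x \<in> M \<Longrightarrow> (\<And>i. i < n \<Longrightarrow> \<phi> x i = 0) \<Longrightarrow> x = 0"
  shows "finitely_generated M"
  using assms
proof (induction n arbitrary: M)
  case 0
  then have "M = {0}"
    using subspace_0 by auto
  then show ?case
    unfolding finitely_generated_def by (intro exI[of _ "{}"]) simp
next
  case (Suc n)
  note sub = Suc.prems(1) and add = Suc.prems(2) and scal = Suc.prems(3) and inj = Suc.prems(4)
  define M' where "M' = {x \<in> M. \<phi> x n = 0}"
  have zero: "\<phi> 0 i = 0" for i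
    using scal[OF subspace_0[OF sub], of 0 i] by simp
  have "finitely_generated M'"
  proof (rule Suc.IH)
    show "subspace M'"
      using sub by (auto simp: subspace_def M'_def add scal zero)
    show "x = 0" if "x \<in> M'" "\<And>i. i < n \<Longrightarrow> \<phi> x i = 0" for x
      using that by (intro inj) (auto simp: M'_def less_Suc_eq)
  qed (auto simp: M'_def add scal)
  then obtain S where S: "finite S" "S \<subseteq> M'" "span S = M'"
    by (auto simp: finitely_generated_def)
  show ?case
  proof (cases "\<forall>x\<in>M. \<phi> x n = 0")
    case True
    then have "M' = M" by (auto simp: M'_def)
    with \<open>finitely_generated M'\<close> show ?thesis by simp
  next
    case False
    then obtain x\<^sub>0 where "x\<^sub>0 \<in> M \<and> \<phi> x\<^sub>0 n \<noteq> 0" by blast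
    from ex_has_least_nat[of "\<lambda>x. x \<in> M \<and> \<phi> x n \<noteq> 0", OF this, of "\<lambda>x. nat \<bar>\<phi> x n\<bar>"]
    obtain m where m: "m \<in> M" "\<phi> m n \<noteq> 0"
      and least: "\<And>x. x \<in> M \<Longrightarrow> \<phi> x n \<noteq> 0 \<Longrightarrow> nat \<bar>\<phi> m n\<bar> \<le> nat \<bar>\<phi> x n\<bar>"
      by blast
    have "x \<in> span (insert m S)" if x: "x \<in> M" for x
    proof -
      define q where "q = \<phi> x n div \<phi> m n"
      have mem: "x - q *s m \<in> M"
        using sub x m by (intro subspace_diff subspace_scale)
      have "\<phi> (x - q *s m) n = \<phi> (x + (- q) *s m) n"
        by simp
      also have "\<dots> = \<phi> x n - q * \<phi> m n"
        using sub x m by (subst add) (auto intro: subspace_scale simp: scal simp del: scale_minus_left)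
      also have "\<dots> = \<phi> x n mod \<phi> m n"
        by (simp add: q_def minus_div_mult_eq_mod)
      finally have eq: "\<phi> (x - q *s m) n = \<phi> x n mod \<phi> m n" .
      have "\<bar>\<phi> x n mod \<phi> m n\<bar> < \<bar>\<phi> m n\<bar>"
        using m(2) by (rule abs_mod_less)
      with least[OF mem] have "\<phi> (x - q *s m) n = 0"
        unfolding eq by linarith
      with mem have "x - q *s m \<in> span S"
        by (simp add: S M'_def)
      then show ?thesis
        by (auto simp: span_insert)
    qed
    moreover have "insert m S \<subseteq> M"
      using S(2) m(1) by (auto simp: M'_def)
    ultimately show ?thesis
      using S(1) span_minimal[OF \<open>insert m S \<subseteq> M\<close> sub]
      unfolding finitely_generated_def by (intro exI[of _ "insert m S"]) auto
  qed
qed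

text \<open>By injectivity, an integer relation between more than \<open>n\<close> coordinate
  vectors lifts to the elements themselves. An infinite \<open>B\<close> is excluded in the same
  way, as it has finite subsets of every size.\<close>

lemma card_independent_le_if_coordinates:
  fixes \<phi> :: "'b \<Rightarrow> nat \<Rightarrow> int"
  assumes sub: "subspace M"
    and add: "\<And>x y i. x \<in> M \<Longrightarrow> y \<in> M \<Longrightarrow> \<phi> (x + y) i = \<phi> x i + \<phi> y i"
    and scal: "\<And>c x i. x \<in> M \<Longrightarrow> \<phi> (c *s x) i = c * \<phi> x i"
    and inj: "\<And>x. x \<in> M \<Longrightarrow> (\<And>i. i < n \<Longrightarrow> \<phi> x i = 0) \<Longrightarrow> x = 0"
    and B: "B \<subseteq> M" "independent B"
  shows "finite B \<and> card B \<le> n"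
proof (rule ccontr)
  assume "\<not> (finite B \<and> card B \<le> n)"
  then obtain C where C: "C \<subseteq> B" "finite C" "n < card C"
    by (metis finite_if_finite_subsets_card_bdd not_le subset_refl)
  obtain c where c: "\<exists>b\<in>C. c b \<noteq> 0" "\<And>i. i < n \<Longrightarrow> (\<Sum>b\<in>C. c b * \<phi> b i) = 0"
    using nontrivial_integer_relation[OF C(2,3), of \<phi>] by blast
  have CM: "C \<subseteq> M" using C B by blast
  have mem: "(\<Sum>b\<in>A. c b *s b) \<in> M" if "A \<subseteq> C" for A
    using that CM by (intro subspace_sum[OF sub] subspace_scale[OF sub]) auto
  have zero: "\<phi> 0 i = 0" for i
    using scal[OF subspace_0[OF sub], of 0 i] by simp
  have "\<phi> (\<Sum>b\<in>A. c b *s b) i = (\<Sum>b\<in>A. c b * \<phi> b i)" if "A \<subseteq> C" for A i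
    using finite_subset[OF that C(2)] that
  proof (induction A rule: finite_induct)
    case (insert b A)
    then show ?case
      using CM sub mem[of A] by (subst sum.insert) (auto simp: add scal subspace_scale)
  qed (simp add: zero)
  then have "(\<Sum>b\<in>C. c b *s b) = 0"
    using c(2) mem by (intro inj) auto
  with c(1) independentD[OF B(2) C(2,1)] show False
    by blast
qed

end

section \<open>Roots of Eisenstein type\<close>

lemma poly_eq_sum_lessThan:
  fixes p :: "'a::comm_semiring_1 poly"
  assumes "degree p < n"
  shows "poly p x = (\<Sum>i<n. coeff p i * x ^ i)"
proof -
  have "poly p x = (\<Sum>i\<le>degree p. coeff p i * x ^ i)"
    by (rule poly_altdef)
  also have "\<dots> = (\<Sum>i<n. coeff p i * x ^ i)"
    using assms by (intro sum.mono_neutral_left) (auto simp: coeff_eq_0)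
  finally show ?thesis .
qed

text \<open>The quotient of c^n by p is rational and an algebraic integer, hence an integer.\<close>

lemma prime_dvd_of_algebraic_int_multiple:
  fixes a :: "'a::field_char_0" and c :: int
  assumes "prime p" "algebraic_int a" "of_int c ^ n = of_nat p * a"
  shows "int p dvd c"
proof -
  have "p \<noteq> 0" using \<open>prime p\<close> by auto
  then have "a = of_int (c ^ n) / of_nat p"
    using assms(3) by (simp add: field_simps)
  then have "a \<in> \<rat>" by simp
  then have "a \<in> \<int>"
    using assms(2) rational_algebraic_int_is_int by blast
  then obtain m where "a = of_int m"
    by (auto elim: Ints_cases)
  then have "(of_int (c ^ n) :: 'a) = of_int (int p * m)"
    using assms(3) by simp
  then have "c ^ n = int p * m"
    by (simp only: of_int_eq_iff)
  then have "int p dvd c ^ n" by simp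
  then show ?thesis
    by (rule prime_dvd_power[rotated]) (use \<open>prime p\<close> in simp)
qed

text \<open>Multiplying a relation \<open>\<Sum>\<^sub>k d\<^sub>k \<theta>\<^sup>k = 0\<close> by \<open>1 + \<theta> s\<close> turns divisibility of \<open>d\<^sub>k\<close> by \<open>p\<close> into
  divisibility by \<open>\<theta>\<^sup>n\<close>.  If \<open>p\<close> divides \<open>d\<^sub>k\<close> for all \<open>k < i\<close>, then \<open>\<theta>\<close> divides \<open>d\<^sub>i\<close>, hence \<open>p\<close>
  divides \<open>d\<^sub>i\<^sup>n\<close>.\<close>

context
  fixes p n :: nat and \<theta> s :: "'a::field_char_0"
  assumes prime: "prime p" and n: "n > 0"
    and \<theta>: "algebraic_int \<theta>" and s: "algebraic_int s"
    and eisenstein: "\<theta> ^ n = - of_nat p * (1 + \<theta> * s)"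
begin

lemma prime_dvd_coeff_if_root:
  assumes "degree d < n" "poly (map_poly of_int d) \<theta> = 0"
  shows "int p dvd coeff d i"
proof (induction i rule: less_induct)
  case (less i)
  show ?case
  proof (cases "i < n")
    case False
    then show ?thesis using assms(1) by (simp add: coeff_eq_0)
  next
    case True
    have "\<theta> \<noteq> 0"
    proof
      assume "\<theta> = 0"
      then show False
        using eisenstein n prime_gt_0_nat[OF prime] by (simp add: power_0_left)
    qed
    define e where "e k = coeff d k div int p" for k
    \<comment> \<open>\<open>X\<close> and \<open>Y\<close> are, up to sign, the cofactors of
      \<theta>^(i + 1) in the terms below and above index \<open>i\<close>. The exponent in
      \<open>X\<close> is not truncated because \<open>i < n\<close>.\<close>
    define X where "X = (\<Sum>k<i. of_int (e k) * \<theta> ^ (n - Suc i + k))"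
    define Y where "Y = (1 + \<theta> * s) * (\<Sum>k\<in>{i<..<n}. of_int (coeff d k) * \<theta> ^ (k - Suc i))"
    have e: "of_int (coeff d k) * (1 + \<theta> * s) = - of_int (e k) * \<theta> ^ n" if "k < i" for k
    proof -
      have "coeff d k = int p * e k"
        using less[OF that] by (simp add: e_def)
      then show ?thesis
        by (simp only: eisenstein of_int_mult of_int_of_nat_eq minus_minus mult_minus_left mult_minus_right mult_ac)
    qed
    have low: "(1 + \<theta> * s) * (\<Sum>k<i. of_int (coeff d k) * \<theta> ^ k) = - (\<theta> ^ Suc i * X)"
      unfolding X_def sum_distrib_left sum_negf[symmetric]
    proof (intro sum.cong refl)
      fix k assume "k \<in> {..<i}"
      then have "(1 + \<theta> * s) * (of_int (coeff d k) * \<theta> ^ k) = - of_int (e k) * (\<theta> ^ n * \<theta> ^ k)"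
        using e[of k] by (simp add: mult_ac)
      also have "\<theta> ^ n * \<theta> ^ k = \<theta> ^ Suc i * \<theta> ^ (n - Suc i + k)"
        using True by (simp flip: power_add power_Suc)
      finally show "(1 + \<theta> * s) * (of_int (coeff d k) * \<theta> ^ k) =
          - (\<theta> ^ Suc i * (of_int (e k) * \<theta> ^ (n - Suc i + k)))"
        by (simp add: mult_ac)
    qed
    have "(\<Sum>k\<in>{i<..<n}. of_int (coeff d k) * \<theta> ^ k) =
        \<theta> ^ Suc i * (\<Sum>k\<in>{i<..<n}. of_int (coeff d k) * \<theta> ^ (k - Suc i))"
      unfolding sum_distrib_left
    proof (intro sum.cong refl)
      fix k assume "k \<in> {i<..<n}"
      then have "\<theta> ^ k = \<theta> ^ Suc i * \<theta> ^ (k - Suc i)"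
        by (simp flip: power_add power_Suc)
      then show "of_int (coeff d k) * \<theta> ^ k = \<theta> ^ Suc i * (of_int (coeff d k) * \<theta> ^ (k - Suc i))"
        by (simp add: mult_ac)
    qed
    then have high: "(1 + \<theta> * s) * (\<Sum>k\<in>{i<..<n}. of_int (coeff d k) * \<theta> ^ k) = \<theta> ^ Suc i * Y"
      by (simp add: Y_def mult_ac)
    have "{..<n} = {..<i} \<union> insert i {i<..<n}"
      using True by auto
    moreover have "0 = (\<Sum>k<n. of_int (coeff d k) * \<theta> ^ k)"
      using poly_eq_sum_lessThan[of "map_poly of_int d" n \<theta>] assms by simp
    moreover have "(\<Sum>k\<in>{..<i} \<union> insert i {i<..<n}. of_int (coeff d k) * \<theta> ^ k) =
        (\<Sum>k<i. of_int (coeff d k) * \<theta> ^ k) + (of_int (coeff d i) * \<theta> ^ i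
        + (\<Sum>k\<in>{i<..<n}. of_int (coeff d k) * \<theta> ^ k))"
      by (subst sum.union_disjoint) auto
    ultimately have "0 = (\<Sum>k<i. of_int (coeff d k) * \<theta> ^ k) + (of_int (coeff d i) * \<theta> ^ i
        + (\<Sum>k\<in>{i<..<n}. of_int (coeff d k) * \<theta> ^ k))"
      by simp
    then have "0 = (1 + \<theta> * s) * ((\<Sum>k<i. of_int (coeff d k) * \<theta> ^ k) + (of_int (coeff d i) * \<theta> ^ i
        + (\<Sum>k\<in>{i<..<n}. of_int (coeff d k) * \<theta> ^ k)))"
      by simp
    also have "\<dots> = - (\<theta> ^ Suc i * X) + (1 + \<theta> * s) * (of_int (coeff d i) * \<theta> ^ i) + \<theta> ^ Suc i * Y"
      by (simp only: distrib_left low high add.assoc)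
    also have "\<dots> = \<theta> ^ i * (of_int (coeff d i) - \<theta> * (X - Y - s * of_int (coeff d i)))"
      by (simp add: algebra_simps)
    finally have *: "of_int (coeff d i) = \<theta> * (X - Y - s * of_int (coeff d i))"
      using \<open>\<theta> \<noteq> 0\<close> by (metis divisors_zero eq_iff_diff_eq_0 power_eq_0_iff)
    \<comment> \<open>The bracket without subtraction, so that the closure rules for algebraic
      integers apply.\<close>
    define a where "a = X + (- Y) + (- (s * of_int (coeff d i)))"
    have "algebraic_int a"
      unfolding a_def X_def Y_def using \<theta> s
      by (intro algebraic_int_add algebraic_int_minus algebraic_int_mult algebraic_int_sum
          algebraic_int_power algebraic_int_of_int algebraic_int_1)
    have "of_int (coeff d i) = \<theta> * a"
      unfolding a_def using * by (simp only: diff_conv_add_uminus)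
    then have "of_int (coeff d i) ^ n = \<theta> ^ n * a ^ n"
      by (simp only: power_mult_distrib)
    also have "\<dots> = of_nat p * (- ((1 + \<theta> * s) * a ^ n))"
      by (simp add: eisenstein)
    finally have "of_int (coeff d i) ^ n = of_nat p * (- ((1 + \<theta> * s) * a ^ n))" .
    moreover have "algebraic_int (- ((1 + \<theta> * s) * a ^ n))"
      using \<theta> s \<open>algebraic_int a\<close>
      by (intro algebraic_int_add algebraic_int_minus algebraic_int_mult algebraic_int_power
          algebraic_int_1)
    ultimately show ?thesis
      using prime_dvd_of_algebraic_int_multiple[OF prime] by blast
  qed
qed

text \<open>The primitive part has the same root, yet \<open>p\<close> would divide all its
  coefficients. Passing to it takes the place of an infinite descent on powers of
  \<open>p\<close>.\<close>

lemma int_poly_eq_0_if_root: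
  assumes "degree d < n" "poly (map_poly of_int d) \<theta> = 0"
  shows "d = 0"
proof (rule ccontr)
  assume "d \<noteq> 0"
  define q where "q = primitive_part d"
  have d: "d = Polynomial.smult (content d) q"
    by (simp add: q_def)
  have "poly (map_poly of_int q) \<theta> = 0"
    using assms(2) \<open>d \<noteq> 0\<close> by (subst (asm) d) (simp add: hom_distribs)
  then have "int p dvd coeff q i" for i
    using prime_dvd_coeff_if_root[of q i] assms(1) by (simp add: q_def)
  then have "int p dvd content q"
    by (simp flip: const_poly_dvd_iff_dvd_content add: const_poly_dvd_iff)
  then have "int p dvd 1"
    using \<open>d \<noteq> 0\<close> by (simp add: q_def)
  then show False
    using prime prime_gt_1_nat by fastforce
qed

end

section \<open>Evaluation of rational polynomials and common denominators\<close>

abbreviation rat_eval :: "rat poly \<Rightarrow> 'a::field_char_0 \<Rightarrow> 'a" where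
  "rat_eval f z \<equiv> poly (map_poly of_rat f) z"

lemma rat_eval_add: "rat_eval (f + g) z = rat_eval f z + rat_eval g z"
  by (simp add: hom_distribs)

lemma rat_eval_uminus: "rat_eval (- f) z = - rat_eval f z"
  by (metis add_eq_0_iff map_poly_0 poly_0 rat_eval_add right_minus)

lemma rat_eval_diff: "rat_eval (f - g) z = rat_eval f z - rat_eval g z"
  using rat_eval_add[of f "- g" z] by (simp add: rat_eval_uminus)

lemma rat_eval_mult: "rat_eval (f * g) z = rat_eval f z * rat_eval g z"
proof -
  interpret map_poly_comm_ring_hom "of_rat :: rat \<Rightarrow> 'a" ..
  show ?thesis by (simp add: hom_mult)
qed

lemma rat_eval_smult: "rat_eval (Polynomial.smult c f) z = of_rat c * rat_eval f z"
  by (simp add: hom_distribs)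

lemma rat_eval_const: "rat_eval [:c:] z = of_rat c"
  by (simp add: hom_distribs)

lemma rat_eval_sum: "rat_eval (\<Sum>i\<in>I. f i) z = (\<Sum>i\<in>I. rat_eval (f i) z)"
  by (induction I rule: infinite_finite_induct) (simp_all add: rat_eval_add)

lemma rat_eval_pcompose: "rat_eval (f \<circ>\<^sub>p g) z = rat_eval f (rat_eval g z)"
  by (simp add: of_rat_hom.map_poly_pcompose poly_pcompose)

lemma rat_eval_of_int_poly: "rat_eval (map_poly of_int f) z = poly (map_poly of_int f) z"
  by (simp add: map_poly_map_poly o_def)

lemma denominator_mult_in_Ints: "of_int (snd (quotient_of r)) * r \<in> \<int>"
proof -
  obtain a b where r: "quotient_of r = (a, b)"
    by (cases "quotient_of r")
  then have "b \<noteq> 0"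
    using quotient_of_nonzero(2)[of r] by simp
  then have "of_int b * r = of_int a"
    using quotient_of_div[OF r] by simp
  then show ?thesis
    by (simp add: r)
qed

lemma rat_poly_common_denominator:
  fixes f :: "rat poly"
  obtains N :: int and g where "N \<noteq> 0" "Polynomial.smult (of_int N) f = map_poly of_int g"
proof
  define N where "N = (\<Prod>i\<le>degree f. snd (quotient_of (coeff f i)))"
  show "N \<noteq> 0"
    by (auto simp: N_def dest: quotient_of_nonzero(2)[THEN notE])
  have "of_int N * coeff f i \<in> \<int>" for i
  proof (cases "i \<le> degree f")
    case True
    define M where "M = (\<Prod>j\<in>{..degree f} - {i}. snd (quotient_of (coeff f j)))"
    have "N = snd (quotient_of (coeff f i)) * M"
      unfolding N_def M_def using True by (intro prod.remove) auto
    then have "of_int N * coeff f i = of_int M * (of_int (snd (quotient_of (coeff f i))) * coeff f i)"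
      by simp
    then show ?thesis
      using denominator_mult_in_Ints[of "coeff f i"] by (simp only: Ints_mult Ints_of_int)
  qed (simp add: coeff_eq_0)
  \<comment> \<open>The products are integers already, so the floor only changes the type.\<close>
  then show "Polynomial.smult (of_int N) f = map_poly of_int (map_poly (\<lambda>r. \<lfloor>of_int N * r\<rfloor>) f)"
    by (intro poly_eqI) (simp add: coeff_map_poly)
qed

text \<open>Clearing denominators reduces this to integer polynomials: \<theta> has degree at least
  \<open>n\<close> over the rationals.\<close>

lemma rat_poly_eq_0_if_root:
  fixes p n :: nat and \<theta> s :: "'a::field_char_0"
  assumes "prime p" "n > 0" "algebraic_int \<theta>" "algebraic_int s"
    and "\<theta> ^ n = - of_nat p * (1 + \<theta> * s)"
    and "degree f < n" "rat_eval f \<theta> = 0"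
  shows "f = 0"
proof -
  obtain N :: int and g where N: "N \<noteq> 0" and g: "Polynomial.smult (of_int N) f = map_poly of_int g"
    using rat_poly_common_denominator by blast
  have "degree g = degree (Polynomial.smult (of_int N) f)"
    by (simp add: g)
  then have "degree g < n"
    using assms(6) N by simp
  moreover have "poly (map_poly of_int g) \<theta> = rat_eval (Polynomial.smult (of_int N) f) \<theta>"
    unfolding g by (rule rat_eval_of_int_poly[symmetric])
  then have "poly (map_poly of_int g) \<theta> = 0"
    using assms(7) by (simp only: rat_eval_smult mult_zero_right)
  ultimately have "g = 0"
    using int_poly_eq_0_if_root[OF assms(1-5)] by blast
  then show ?thesis
    using g N by simp
qed

section \<open>Prime cyclotomic fields\<close>

definition prime_cyclotomic :: "nat \<Rightarrow> rat poly" where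
  "prime_cyclotomic p = (\<Sum>k<p. monom 1 k)"

lemma coeff_prime_cyclotomic: "coeff (prime_cyclotomic p) k = (if k < p then 1 else 0)"
  by (simp add: prime_cyclotomic_def coeff_sum)

lemma degree_prime_cyclotomic:
  assumes "p > 0"
  shows "degree (prime_cyclotomic p) = p - 1"
proof (rule antisym)
  show "degree (prime_cyclotomic p) \<le> p - 1"
    by (rule degree_le) (auto simp: coeff_prime_cyclotomic)
  show "p - 1 \<le> degree (prime_cyclotomic p)"
    using assms by (intro le_degree) (simp add: coeff_prime_cyclotomic)
qed

lemma rat_eval_prime_cyclotomic:
  assumes "z ^ p = 1" "z \<noteq> 1"
  shows "rat_eval (prime_cyclotomic p) z = 0"
  using assms by (simp add: prime_cyclotomic_def rat_eval_sum poly_monom sum_gp_strict)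

locale prime_root_of_unity =
  fixes p :: nat and \<zeta> :: "'a::field_char_0"
  assumes prime: "prime p" and primitive: "primitive_root_of_unity p \<zeta>"
begin

lemma p_gt_1: "p > 1"
  using prime prime_gt_1_nat by blast

lemma root_power: "\<zeta> ^ p = 1"
  using primitive by (simp add: primitive_root_of_unity_def)

lemma power_root_power: "(\<zeta> ^ m) ^ p = 1"
  unfolding power_mult[symmetric] mult.commute[of m p] by (simp add: power_mult root_power)

lemma power_eq_1_iff_dvd: "\<zeta> ^ m = 1 \<longleftrightarrow> p dvd m"
proof -
  have "\<zeta> ^ m = \<zeta> ^ (p * (m div p) + m mod p)"
    by simp
  also have "\<dots> = \<zeta> ^ (m mod p)"
    unfolding power_add power_mult by (simp add: root_power)
  finally have "\<zeta> ^ m = \<zeta> ^ (m mod p)" .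
  moreover have "m mod p < p"
    using p_gt_1 by simp
  ultimately show ?thesis
    using primitive unfolding primitive_root_of_unity_def dvd_eq_mod_eq_0
    by (metis gr0I power_0)
qed

lemma algebraic_int_root_of_unity: "algebraic_int \<zeta>"
proof -
  show ?thesis
  proof (rule algebraic_int_root)
    show "algebraic_int (1 :: 'a)" by simp
    show "poly (monom 1 p) \<zeta> = 1" by (simp add: poly_monom root_power)
    show "\<forall>i. coeff (monom 1 p :: 'a poly) i \<in> \<int>" by simp
    show "lead_coeff (monom 1 p :: 'a poly) = 1" by (simp add: degree_monom_eq)
    show "degree (monom 1 p :: 'a poly) > 0" using p_gt_1 by (simp add: degree_monom_eq)
  qed
qed

text \<open>Expand 1 = (1 + \<theta>)^p with \<theta> = \<zeta> - 1 and cancel one \<theta>. The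
  linear term leaves p; the terms with exponents from 2 to p - 1 have binomial coefficients
  divisible by p and go into \<open>s\<close>.\<close>

lemma eisenstein_identity:
  obtains s where "algebraic_int s" "(\<zeta> - 1) ^ (p - 1) = - of_nat p * (1 + (\<zeta> - 1) * s)"
proof -
  define \<theta> where "\<theta> = \<zeta> - 1"
  have \<theta>: "algebraic_int \<theta>"
    using algebraic_int_add[OF algebraic_int_root_of_unity algebraic_int_minus[OF algebraic_int_1]]
    by (simp add: \<theta>_def)
  have "\<theta> \<noteq> 0"
    using power_eq_1_iff_dvd[of 1] p_gt_1 by (auto simp: \<theta>_def)
  define s where "s = (\<Sum>k\<in>{2..<p}. of_nat ((p choose k) div p) * \<theta> ^ (k - 2))"
  have "algebraic_int s"
    unfolding s_def using \<theta>
    by (intro algebraic_int_sum algebraic_int_mult algebraic_int_power algebraic_int_of_nat)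
  have mid: "(\<Sum>k\<in>{2..<p}. of_nat (p choose k) * \<theta> ^ k) = of_nat p * \<theta> ^ 2 * s"
    unfolding s_def sum_distrib_left
  proof (intro sum.cong refl)
    fix k assume k: "k \<in> {2..<p}"
    then have "p dvd p choose k"
      using prime by (intro dvd_choose_prime) auto
    then have "(of_nat (p choose k) :: 'a) = of_nat p * of_nat ((p choose k) div p)"
      by (metis dvd_mult_div_cancel of_nat_mult)
    moreover have "\<theta> ^ (2 + (k - 2)) = \<theta> ^ 2 * \<theta> ^ (k - 2)"
      by (rule power_add)
    then have "\<theta> ^ k = \<theta> ^ 2 * \<theta> ^ (k - 2)"
      using k by (simp only: atLeastLessThan_iff le_add_diff_inverse)
    ultimately show "of_nat (p choose k) * \<theta> ^ k =
        of_nat p * \<theta> ^ 2 * (of_nat ((p choose k) div p) * \<theta> ^ (k - 2))"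
      by (simp add: mult_ac)
  qed
  have "{..p} = {0, 1} \<union> ({2..<p} \<union> {p})"
    using p_gt_1 by auto
  moreover have "(\<Sum>k\<in>{0, 1} \<union> ({2..<p} \<union> {p}). of_nat (p choose k) * \<theta> ^ k) =
      1 + of_nat p * \<theta> + (of_nat p * \<theta> ^ 2 * s + \<theta> ^ p)"
    using p_gt_1 by (subst sum.union_disjoint, simp, simp, force)+ (simp add: mid)
  moreover have "1 = (\<theta> + 1) ^ p"
    by (simp add: \<theta>_def root_power)
  ultimately have "0 = of_nat p * \<theta> + (of_nat p * \<theta> ^ 2 * s + \<theta> ^ p)"
    by (simp add: binomial_ring)
  also have "\<theta> ^ p = \<theta> * \<theta> ^ (p - 1)"
    using p_gt_1 by (simp flip: power_Suc)
  also have "of_nat p * \<theta> + (of_nat p * \<theta> ^ 2 * s + \<theta> * \<theta> ^ (p - 1)) =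
      \<theta> * (of_nat p * (1 + \<theta> * s) + \<theta> ^ (p - 1))"
    by (simp add: algebra_simps power2_eq_square)
  finally have "\<theta> ^ (p - 1) = - (of_nat p * (1 + \<theta> * s))"
    using \<open>\<theta> \<noteq> 0\<close> by (simp add: add_eq_0_iff)
  with \<open>algebraic_int s\<close> show thesis
    using that by (simp add: \<theta>_def)
qed

text \<open>The substitution of X + 1 for X preserves degrees and moves the root to
  \<open>\<zeta> - 1\<close>, which satisfies an equation of Eisenstein type.\<close>

lemma rat_eval_root_eq_0_iff:
  assumes "degree f < p - 1"
  shows "rat_eval f \<zeta> = 0 \<longleftrightarrow> f = 0"
proof
  assume f: "rat_eval f \<zeta> = 0"
  obtain s where s: "algebraic_int s" "(\<zeta> - 1) ^ (p - 1) = - of_nat p * (1 + (\<zeta> - 1) * s)"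
    using eisenstein_identity by blast
  have \<theta>: "algebraic_int (\<zeta> - 1)"
    using algebraic_int_add[OF algebraic_int_root_of_unity algebraic_int_minus[OF algebraic_int_1]]
    by simp
  have "rat_eval (f \<circ>\<^sub>p [:1, 1:]) (\<zeta> - 1) = 0"
    using f unfolding rat_eval_pcompose by (simp add: hom_distribs)
  then have "f \<circ>\<^sub>p [:1, 1:] = 0"
    using rat_poly_eq_0_if_root[OF prime _ \<theta> s] assms p_gt_1 by simp
  then show "f = 0"
    by (simp add: pcompose_eq_0_iff)
qed simp

lemma rat_eval_mod_prime_cyclotomic:
  assumes "z ^ p = 1" "z \<noteq> 1"
  shows "rat_eval (f mod prime_cyclotomic p) z = rat_eval f z"
proof -
  have "rat_eval f z = rat_eval (f div prime_cyclotomic p * prime_cyclotomic p + f mod prime_cyclotomic p) z"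
    by simp
  also have "\<dots> = rat_eval (f mod prime_cyclotomic p) z"
    by (simp only: rat_eval_add rat_eval_mult rat_eval_prime_cyclotomic[OF assms]) simp
  finally show ?thesis ..
qed

lemma degree_mod_prime_cyclotomic: "degree (f mod prime_cyclotomic p) < p - 1"
  using degree_mod_less'[of "prime_cyclotomic p" f] degree_prime_cyclotomic[of p] p_gt_1
  by (cases "f mod prime_cyclotomic p = 0") fastforce+

lemma root_neq_1: "\<zeta> \<noteq> 1"
  using power_eq_1_iff_dvd[of 1] p_gt_1 by auto

text \<open>The remainder of \<open>f\<close> modulo the cyclotomic polynomial vanishes at \<zeta>
  and has degree below p - 1, so it is zero. This stands in for the automorphism that sends \<zeta>
  to \<open>z\<close>.\<close>

lemma rat_eval_conjugate_eq_0:
  assumes "rat_eval f \<zeta> = 0" "z ^ p = 1" "z \<noteq> 1"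
  shows "rat_eval f z = 0"
proof -
  have "rat_eval (f mod prime_cyclotomic p) \<zeta> = 0"
    using assms(1) by (simp add: rat_eval_mod_prime_cyclotomic root_power root_neq_1)
  then have "f mod prime_cyclotomic p = 0"
    using rat_eval_root_eq_0_iff[OF degree_mod_prime_cyclotomic] by blast
  then show ?thesis
    using rat_eval_mod_prime_cyclotomic[OF assms(2,3), of f] by simp
qed

text \<open>Bezout: the gcd of \<open>f\<close> and the cyclotomic polynomial is constant, because
  its cofactor in the latter vanishes at \<zeta> and so already has degree at least p - 1.\<close>

lemma rat_eval_inverse:
  obtains g where "rat_eval g \<zeta> = inverse (rat_eval f \<zeta>)"
proof (cases "rat_eval f \<zeta> = 0")
  case True
  \<comment> \<open>Here \<open>inverse 0 = 0\<close> is the value of the zero polynomial.\<close>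
  then show thesis using that[of 0] by simp
next
  case False
  let ?\<Phi> = "prime_cyclotomic p"
  define d where "d = gcd f ?\<Phi>"
  have \<Phi>: "rat_eval ?\<Phi> \<zeta> = 0"
    by (intro rat_eval_prime_cyclotomic root_power root_neq_1)
  have "?\<Phi> \<noteq> 0"
    using degree_prime_cyclotomic[of p] coeff_prime_cyclotomic[of p 0] p_gt_1 by auto
  obtain a where a: "f = d * a"
    unfolding d_def using gcd_dvd1 by blast
  obtain h where h: "?\<Phi> = d * h"
    unfolding d_def using gcd_dvd2 by blast
  have "d \<noteq> 0" "h \<noteq> 0"
    using h \<open>?\<Phi> \<noteq> 0\<close> by auto
  have "rat_eval d \<zeta> \<noteq> 0"
    using False a by (auto simp: rat_eval_mult)
  then have "rat_eval h \<zeta> = 0"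
    using \<Phi> by (simp add: h rat_eval_mult)
  then have "p - 1 \<le> degree h"
    using rat_eval_root_eq_0_iff[of h] \<open>h \<noteq> 0\<close> by (meson not_le)
  moreover have "p - 1 = degree d + degree h"
    using degree_prime_cyclotomic[of p] p_gt_1 \<open>d \<noteq> 0\<close> \<open>h \<noteq> 0\<close> by (simp add: h degree_mult_eq)
  ultimately have "degree d = 0" by simp
  then obtain c where c: "d = [:c:]"
    by (rule degree_eq_zeroE)
  obtain u v where "u * f + v * ?\<Phi> = d"
    unfolding d_def using bezout_coefficients_fst_snd by blast
  then have "rat_eval (u * f + v * ?\<Phi>) \<zeta> = of_rat c"
    using c by (simp add: rat_eval_const)
  then have uf: "rat_eval u \<zeta> * rat_eval f \<zeta> = of_rat c"
    by (simp add: rat_eval_add rat_eval_mult \<Phi>)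
  moreover have "c \<noteq> 0" using c \<open>d \<noteq> 0\<close> by simp
  moreover have "rat_eval u \<zeta> \<noteq> 0"
    using uf \<open>c \<noteq> 0\<close> by (metis mult_zero_left of_rat_eq_0_iff)
  ultimately have "rat_eval (Polynomial.smult (inverse c) u) \<zeta> = inverse (rat_eval f \<zeta>)"
    using False unfolding rat_eval_smult of_rat_inverse by (auto simp: uf[symmetric])
  then show thesis using that by blast
qed

lemma rat_adjoin_eq: "rat_adjoin \<zeta> = range (\<lambda>f. rat_eval f \<zeta>)"
proof
  have "is_subfield (range (\<lambda>f. rat_eval f \<zeta>))"
    unfolding is_subfield_def
  proof (intro conjI ballI)
    fix x assume "x \<in> range (\<lambda>f. rat_eval f \<zeta>)"
    then obtain f where "x = rat_eval f \<zeta>" by blast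
    moreover obtain g where "rat_eval g \<zeta> = inverse (rat_eval f \<zeta>)"
      using rat_eval_inverse by blast
    ultimately show "inverse x \<in> range (\<lambda>f. rat_eval f \<zeta>)"
      by (metis rangeI)
  qed (auto simp flip: rat_eval_add rat_eval_mult rat_eval_uminus
        intro: range_eqI[of _ _ 0] range_eqI[of _ _ 1])
  moreover have "\<zeta> \<in> range (\<lambda>f. rat_eval f \<zeta>)"
    by (rule range_eqI[of _ _ "monom 1 1"]) (simp add: poly_monom)
  ultimately show "rat_adjoin \<zeta> \<subseteq> range (\<lambda>f. rat_eval f \<zeta>)"
    unfolding rat_adjoin_def by (intro hull_minimal) auto
next
  have "rat_eval f \<zeta> \<in> F" if F: "is_subfield F" "\<zeta> \<in> F" for f F
  proof -
    have nat: "of_nat k \<in> F" for k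
      using F(1) by (induction k) (auto simp: is_subfield_def)
    have int: "of_int k \<in> F" for k
      using nat F(1) by (cases k rule: int_cases2) (auto simp: is_subfield_def)
    have rat: "of_rat r \<in> F" for r
    proof -
      obtain a b where "r = of_int a / of_int b"
        by (metis quotient_of_div surj_pair)
      then have "of_rat r = (of_int a * inverse (of_int b) :: 'a)"
        unfolding divide_inverse[symmetric] by (simp add: of_rat_divide)
      with int show ?thesis using F(1) by (simp add: is_subfield_def)
    qed
    show ?thesis
      using F rat by (induction f) (auto simp: hom_distribs is_subfield_def)
  qed
  then show "range (\<lambda>f. rat_eval f \<zeta>) \<subseteq> rat_adjoin \<zeta>"
    unfolding rat_adjoin_def hull_def by (intro subsetI InterI) auto
qed

lemma rat_adjoin_obtain_poly:
  assumes "x \<in> rat_adjoin \<zeta>"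
  obtains f where "degree f < p - 1" "x = rat_eval f \<zeta>"
proof -
  obtain f where "x = rat_eval f \<zeta>"
    using assms by (auto simp: rat_adjoin_eq)
  then have "x = rat_eval (f mod prime_cyclotomic p) \<zeta>"
    by (simp add: rat_eval_mod_prime_cyclotomic root_power root_neq_1)
  then show thesis
    using that degree_mod_prime_cyclotomic by blast
qed

text \<open>If a monic \<open>g\<close> annihilates f(\<zeta>), then the composition of
  \<open>g\<close> with \<open>f\<close> vanishes at \<zeta>, hence at \<open>z\<close>.\<close>

lemma algebraic_int_conjugate:
  fixes z :: 'a
  assumes "algebraic_int (rat_eval f \<zeta>)" "z ^ p = 1" "z \<noteq> 1"
  shows "algebraic_int (rat_eval f z)"
proof -
  obtain g where g: "poly (map_poly of_int g) (rat_eval f \<zeta>) = 0" "lead_coeff g = 1"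
    using assms(1) by (auto simp: algebraic_int_altdef_ipoly)
  have comp: "rat_eval (map_poly of_int g \<circ>\<^sub>p f) w = poly (map_poly of_int g) (rat_eval f w)" for w :: 'a
    unfolding rat_eval_pcompose by (rule rat_eval_of_int_poly)
  have "poly (map_poly of_int g) (rat_eval f z) = 0"
    using rat_eval_conjugate_eq_0[OF _ assms(2,3), of "map_poly of_int g \<circ>\<^sub>p f"] g(1)
    unfolding comp by blast
  with g(2) show ?thesis
    by (auto simp: algebraic_int_altdef_ipoly)
qed

text \<open>Orthogonality of the characters of the cyclic group of order p: a geometric sum unless
  the ratio is 1.\<close>

lemma sum_powers_root: "(\<Sum>j<p. (\<zeta> ^ m) ^ j) = (if p dvd m then of_nat p else 0)"
proof (cases "p dvd m")
  case True
  then have "\<zeta> ^ m = 1" by (simp add: power_eq_1_iff_dvd)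
  with True show ?thesis by simp
next
  case False
  then have "\<zeta> ^ m \<noteq> 1" by (simp add: power_eq_1_iff_dvd)
  moreover have "(\<zeta> ^ m) ^ p = 1"
    by (rule power_root_power)
  ultimately show ?thesis
    using False by (simp add: sum_gp_strict)
qed

text \<open>The trace of \<open>x (\<zeta>\<^sup>p\<^sup>-\<^sup>k - \<zeta>)\<close> is \<open>p\<close> times the coefficient of \<open>\<zeta>\<^sup>k\<close> in \<open>x\<close>.\<close>

lemma coeff_times_prime_in_Ints:
  assumes "algebraic_int (rat_eval f \<zeta>)" "degree f < p - 1"
  shows "of_nat p * coeff f k \<in> \<int>"
proof (cases "k < p - 1")
  case k: True
  \<comment> \<open>With c_i the coefficients of \<open>f\<close>, multiplying by \<zeta>^(-k),
    written with exponent p - k, gives the trace p c_k minus the sum of all c_i. Multiplying by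
    \<zeta> gives minus that sum, so the difference isolates p c_k.\<close>
  define S where "S = (\<Sum>j\<in>{1..<p}. rat_eval f (\<zeta> ^ j) * ((\<zeta> ^ j) ^ (p - k) + - (\<zeta> ^ j)))"
  have "algebraic_int (rat_eval f (\<zeta> ^ j))" if "j \<in> {1..<p}" for j
  proof (rule algebraic_int_conjugate[OF assms(1)])
    show "(\<zeta> ^ j) ^ p = 1"
      by (rule power_root_power)
    show "\<zeta> ^ j \<noteq> 1"
      using that by (auto simp: power_eq_1_iff_dvd dest: dvd_imp_le)
  qed
  then have "algebraic_int S"
    unfolding S_def
    by (intro algebraic_int_sum algebraic_int_mult algebraic_int_add algebraic_int_minus
        algebraic_int_power algebraic_int_root_of_unity)
  have "{..<p} = insert 0 {1..<p}"
    using p_gt_1 by auto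
  \<comment> \<open>The summand for j = 0 is f(1) (1 - 1) = 0; including it makes the sums run over
    all p-th roots of unity, as orthogonality requires.\<close>
  then have "S = (\<Sum>j<p. rat_eval f (\<zeta> ^ j) * ((\<zeta> ^ j) ^ (p - k) - \<zeta> ^ j))"
    by (simp add: S_def)
  also have "\<dots> = (\<Sum>j<p. \<Sum>i<p - 1. of_rat (coeff f i) * ((\<zeta> ^ (i + (p - k))) ^ j - (\<zeta> ^ (i + 1)) ^ j))"
  proof (intro sum.cong refl)
    fix j
    have "rat_eval f (\<zeta> ^ j) = (\<Sum>i<p - 1. of_rat (coeff f i) * (\<zeta> ^ j) ^ i)"
      using poly_eq_sum_lessThan[of "map_poly of_rat f" "p - 1" "\<zeta> ^ j"] assms(2) by simp
    moreover have pow: "(\<zeta> ^ m) ^ j = (\<zeta> ^ j) ^ m" for m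
      unfolding power_mult[symmetric] mult.commute[of m j] ..
    ultimately show "rat_eval f (\<zeta> ^ j) * ((\<zeta> ^ j) ^ (p - k) - \<zeta> ^ j) =
        (\<Sum>i<p - 1. of_rat (coeff f i) * ((\<zeta> ^ (i + (p - k))) ^ j - (\<zeta> ^ (i + 1)) ^ j))"
      unfolding pow[of "_ + _"] power_add by (simp add: sum_distrib_left algebra_simps)
  qed
  also have "\<dots> = (\<Sum>i<p - 1. of_rat (coeff f i) *
      ((\<Sum>j<p. (\<zeta> ^ (i + (p - k))) ^ j) - (\<Sum>j<p. (\<zeta> ^ (i + 1)) ^ j)))"
    by (subst sum.swap) (simp only: sum_distrib_left sum_subtractf right_diff_distrib)
  also have "\<dots> = (\<Sum>i<p - 1. of_rat (coeff f i) * (if i = k then of_nat p else 0))"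
  proof (intro sum.cong refl)
    fix i assume "i \<in> {..<p - 1}"
    then have i: "i < p - 1" by simp
    \<comment> \<open>The only multiple of p strictly between 0 and 2 p is p itself.\<close>
    have "p dvd i + (p - k) \<longleftrightarrow> i = k"
    proof
      assume "p dvd i + (p - k)"
      then obtain q where q: "i + (p - k) = p * q" ..
      then have "0 < p * q" "p * q < p * 2"
        using i k by linarith+
      then have "q = 1"
        using p_gt_1 by auto
      with q k show "i = k" by simp
    qed (use k in simp)
    \<comment> \<open>The degree bound enters here: i + 1 < p.\<close>
    moreover have "\<not> p dvd i + 1"
      using i by (auto dest: dvd_imp_le)
    ultimately show "of_rat (coeff f i) * ((\<Sum>j<p. (\<zeta> ^ (i + (p - k))) ^ j) - (\<Sum>j<p. (\<zeta> ^ (i + 1)) ^ j)) =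
        of_rat (coeff f i) * (if i = k then of_nat p else 0)"
      by (simp only: sum_powers_root) simp
  qed
  also have "\<dots> = of_rat (of_nat p * coeff f k)"
    using k by (simp add: if_distrib[of "\<lambda>x. _ * x"] of_rat_mult mult.commute cong: if_cong)
  finally have "S = of_rat (of_nat p * coeff f k)" .
  with \<open>algebraic_int S\<close> have "of_rat (of_nat p * coeff f k) \<in> (\<int> :: 'a set)"
    by (intro rational_algebraic_int_is_int) auto
  then obtain m where "of_rat (of_nat p * coeff f k) = (of_int m :: 'a)"
    by (auto elim: Ints_cases)
  then have "of_nat p * coeff f k = of_int m"
    by (metis of_rat_eq_iff of_rat_of_int_eq)
  then show ?thesis by simp
qed (use assms in \<open>simp add: coeff_eq_0\<close>)

end

section \<open>Twisted derivations\<close>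

text \<open>Additivity is available inside \<open>R\<close> only, so each step of the induction,
  upwards and downwards, needs the integer multiples of \<open>x\<close> to lie in
  \<open>R\<close>.\<close>

lemma ring_endo_on_of_int_mult:
  assumes "ring_endo_on R f" "x \<in> R" and mult_mem: "\<And>n x. x \<in> R \<Longrightarrow> of_int n * x \<in> R"
  shows "f (of_int n * x) = of_int n * f x"
proof -
  have add: "f (u + v) = f u + f v" if "u \<in> R" "v \<in> R" for u v
    using assms(1) that by (simp add: ring_endo_on_def)
  have zero: "f 0 = 0"
    using add[of "of_int 0 * x" "of_int 0 * x"] mult_mem[OF assms(2), of 0] by simp
  show ?thesis
  proof (induction n rule: int_induct[of _ 0])
    case (step1 i)
    then show ?case
      using add[OF mult_mem[OF assms(2), of i] assms(2)] by (simp add: algebra_simps)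
  next
    case (step2 i)
    then show ?case
      using add[OF mult_mem[OF assms(2), of "i - 1"] assms(2)] by (simp add: algebra_simps)
  qed (simp add: zero)
qed

lemma twisted_derivation_cross_mult:
  fixes R :: "'a::comm_ring_1 set"
  assumes "D \<in> twisted_derivations R \<sigma> \<tau>" "x \<in> R" "y \<in> R"
  shows "D x * (\<tau> y - \<sigma> y) = D y * (\<tau> x - \<sigma> x)"
proof -
  have "D x * \<tau> y + \<sigma> x * D y = D (x * y)"
    using assms by (simp add: twisted_derivations_def)
  also have "\<dots> = D y * \<tau> x + \<sigma> y * D x"
    using assms by (subst mult.commute) (simp add: twisted_derivations_def)
  finally show ?thesis by (simp add: algebra_simps)
qed

text \<open>Over a commutative ring this is the twisted commutator a \<tau>(x) - \<sigma>(x) a,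
  whence the name. The value 0 outside \<open>R\<close> is the normal form demanded by
  \<open>twisted_derivations\<close>.\<close>

definition inner_derivation :: "'a::ring_1 set \<Rightarrow> ('a \<Rightarrow> 'a) \<Rightarrow> ('a \<Rightarrow> 'a) \<Rightarrow> 'a \<Rightarrow> 'a \<Rightarrow> 'a" where
  "inner_derivation R \<sigma> \<tau> a x = (if x \<in> R then a * (\<tau> x - \<sigma> x) else 0)"

interpretation derivations: int_module "int_scale :: int \<Rightarrow> ('b \<Rightarrow> 'a::ring_1) \<Rightarrow> 'b \<Rightarrow> 'a" ..

context prime_root_of_unity
begin

abbreviation integers :: "'a set" where
  "integers \<equiv> ring_of_integers (rat_adjoin \<zeta>)"

lemma integers_add: "x \<in> integers \<Longrightarrow> y \<in> integers \<Longrightarrow> x + y \<in> integers"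
  by (auto simp: ring_of_integers_def rat_adjoin_eq algebraic_int_add simp flip: rat_eval_add)

lemma integers_mult: "x \<in> integers \<Longrightarrow> y \<in> integers \<Longrightarrow> x * y \<in> integers"
  by (auto simp: ring_of_integers_def rat_adjoin_eq algebraic_int_mult simp flip: rat_eval_mult)

lemma integers_of_int: "of_int n \<in> integers"
proof -
  have "of_int n = rat_eval [:of_int n:] \<zeta>"
    by (simp only: rat_eval_const of_rat_of_int_eq)
  then have "of_int n \<in> rat_adjoin \<zeta>"
    unfolding rat_adjoin_eq by (rule range_eqI)
  then show ?thesis
    by (simp add: ring_of_integers_def)
qed

lemma integers_of_int_mult: "x \<in> integers \<Longrightarrow> of_int n * x \<in> integers"
  by (intro integers_mult integers_of_int)

lemma integers_power_root: "\<zeta> ^ i \<in> integers"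
  using range_eqI[of "\<zeta> ^ i" "\<lambda>f. rat_eval f \<zeta>" "monom 1 i"]
  by (simp add: ring_of_integers_def rat_adjoin_eq algebraic_int_power algebraic_int_root_of_unity poly_monom)

lemma integers_diff: "x \<in> integers \<Longrightarrow> y \<in> integers \<Longrightarrow> x - y \<in> integers"
  using integers_add[OF _ integers_of_int_mult[of y "-1"]] by simp

section \<open>Integer coordinates on the ring of integers\<close>

definition rat_poly_of :: "'a \<Rightarrow> rat poly" where
  "rat_poly_of x = (THE f. degree f < p - 1 \<and> rat_eval f \<zeta> = x)"

text \<open>Two such polynomials with the same value at \<zeta> differ by one of degree below p - 1
  that vanishes there, so the description in \<open>rat_poly_of\<close> is unique.\<close>

lemma rat_poly_of_eqI:
  assumes "degree f < p - 1" "rat_eval f \<zeta> = x"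
  shows "rat_poly_of x = f"
  unfolding rat_poly_of_def
proof (rule the_equality)
  fix g assume g: "degree g < p - 1 \<and> rat_eval g \<zeta> = x"
  then have "rat_eval (g - f) \<zeta> = 0"
    unfolding rat_eval_diff using assms by simp
  moreover have "degree (g - f) < p - 1"
    using g assms(1) by (meson degree_diff_less)
  ultimately show "g = f"
    using rat_eval_root_eq_0_iff[of "g - f"] by simp
qed (use assms in blast)

lemma
  assumes "x \<in> rat_adjoin \<zeta>"
  shows degree_rat_poly_of: "degree (rat_poly_of x) < p - 1"
    and rat_eval_rat_poly_of: "rat_eval (rat_poly_of x) \<zeta> = x"
  using rat_adjoin_obtain_poly[OF assms] rat_poly_of_eqI by metis+

text \<open>The factor p clears the denominators in the coefficients of an algebraic integer, so the
  floor is exact on the ring of integers.\<close>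

definition integral_coord :: "'a \<Rightarrow> nat \<Rightarrow> int" where
  "integral_coord x i = \<lfloor>of_nat p * coeff (rat_poly_of x) i\<rfloor>"

lemma of_int_integral_coord:
  assumes "x \<in> integers"
  shows "of_int (integral_coord x i) = of_nat p * coeff (rat_poly_of x) i"
proof -
  have x: "x \<in> rat_adjoin \<zeta>" "algebraic_int x"
    using assms by (auto simp: ring_of_integers_def)
  have "of_nat p * coeff (rat_poly_of x) i \<in> \<int>"
    using coeff_times_prime_in_Ints[OF _ degree_rat_poly_of[OF x(1)], of i] x
    by (simp add: rat_eval_rat_poly_of)
  then show ?thesis
    by (simp add: integral_coord_def)
qed

lemma integral_coord_add:
  assumes "x \<in> integers" "y \<in> integers"
  shows "integral_coord (x + y) i = integral_coord x i + integral_coord y i"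
proof -
  have xy: "x \<in> rat_adjoin \<zeta>" "y \<in> rat_adjoin \<zeta>"
    using assms by (auto simp: ring_of_integers_def)
  have "rat_poly_of (x + y) = rat_poly_of x + rat_poly_of y"
    using xy by (intro rat_poly_of_eqI degree_add_less degree_rat_poly_of)
      (simp_all only: rat_eval_add rat_eval_rat_poly_of)
  \<comment> \<open>The comparison takes place in the rationals, where exactness removes the
    floors.\<close>
  then have "(of_int (integral_coord (x + y) i) :: rat) = of_int (integral_coord x i + integral_coord y i)"
    using assms by (simp add: of_int_integral_coord integers_add distrib_left)
  then show ?thesis
    by (simp only: of_int_eq_iff)
qed

lemma integral_coord_of_int_mult:
  assumes "x \<in> integers"
  shows "integral_coord (of_int n * x) i = n * integral_coord x i"
proof -
  have x: "x \<in> rat_adjoin \<zeta>"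
    using assms by (auto simp: ring_of_integers_def)
  have "rat_poly_of (of_int n * x) = Polynomial.smult (of_int n) (rat_poly_of x)"
  proof (rule rat_poly_of_eqI)
    show "degree (Polynomial.smult (of_int n) (rat_poly_of x)) < p - 1"
      using degree_smult_le le_less_trans degree_rat_poly_of[OF x] by blast
  qed (simp only: rat_eval_smult rat_eval_rat_poly_of[OF x] of_rat_of_int_eq)
  then have "(of_int (integral_coord (of_int n * x) i) :: rat) = of_int (n * integral_coord x i)"
    using assms by (simp add: of_int_integral_coord integers_of_int_mult)
  then show ?thesis
    by (simp only: of_int_eq_iff)
qed

lemma integral_coord_eq_0D:
  assumes "x \<in> integers" "\<And>i. i < p - 1 \<Longrightarrow> integral_coord x i = 0"
  shows "x = 0"
proof -
  have x: "x \<in> rat_adjoin \<zeta>"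
    using assms by (auto simp: ring_of_integers_def)
  have "coeff (rat_poly_of x) i = 0" for i
  proof (cases "i < p - 1")
    case True
    then show ?thesis
      using of_int_integral_coord[OF assms(1), of i] assms(2) p_gt_1 by simp
  next
    case False
    then show ?thesis
      using degree_rat_poly_of[OF x] by (intro coeff_eq_0) simp
  qed
  then have "rat_poly_of x = 0"
    by (intro poly_eqI) simp
  then show ?thesis
    using rat_eval_rat_poly_of[OF x] by simp
qed

lemma int_combination_eq_0:
  assumes "(\<Sum>i<p - 1. of_int (u i) * \<zeta> ^ i) = 0" "i < p - 1"
  shows "u i = 0"
proof -
  define f :: "rat poly" where "f = (\<Sum>i<p - 1. monom (of_int (u i)) i)"
  have coeff: "coeff f j = (if j < p - 1 then of_int (u j) else 0)" for j
    by (simp add: f_def coeff_sum)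
  have "degree f < p - 1"
    using assms(2) by (intro degree_lessI) (auto simp: coeff)
  moreover have "rat_eval f \<zeta> = 0"
    unfolding f_def rat_eval_sum using assms(1) by (simp add: poly_monom)
  ultimately have "f = 0"
    using rat_eval_root_eq_0_iff by blast
  then show ?thesis
    using coeff[of i] assms(2) by simp
qed

section \<open>Derivations twisted by two endomorphisms that differ at y\<close>

context
  fixes \<sigma> \<tau> :: "'a \<Rightarrow> 'a" and y
  assumes endo: "ring_endo_on integers \<sigma>" "ring_endo_on integers \<tau>"
    and y: "y \<in> integers" "\<sigma> y \<noteq> \<tau> y"
begin

text \<open>The product rule telescopes: \<tau>(x z) - \<sigma>(x z) = (\<tau>(x) - \<sigma>(x))
  \<tau>(z) + \<sigma>(x) (\<tau>(z) - \<sigma>(z)).\<close>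

lemma inner_derivation_in_twisted_derivations:
  assumes a: "a \<in> integers"
  shows "inner_derivation integers \<sigma> \<tau> a \<in> twisted_derivations integers \<sigma> \<tau>"
proof -
  have endo_mem: "\<sigma> x \<in> integers" "\<tau> x \<in> integers" if "x \<in> integers" for x
    using endo that by (auto simp: ring_endo_on_def)
  have endo_add: "\<sigma> (x + z) = \<sigma> x + \<sigma> z" "\<tau> (x + z) = \<tau> x + \<tau> z"
    and endo_mult: "\<sigma> (x * z) = \<sigma> x * \<sigma> z" "\<tau> (x * z) = \<tau> x * \<tau> z"
    if "x \<in> integers" "z \<in> integers" for x z
    using endo that by (simp_all add: ring_endo_on_def)
  have endo_scale: "\<sigma> (of_int n * x) = of_int n * \<sigma> x" "\<tau> (of_int n * x) = of_int n * \<tau> x"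
    if "x \<in> integers" for n x
    using that endo by (auto intro!: ring_endo_on_of_int_mult integers_of_int_mult)
  define D where "D = inner_derivation integers \<sigma> \<tau> a"
  have D: "D x = a * (\<tau> x - \<sigma> x)" if "x \<in> integers" for x
    using that by (simp add: D_def inner_derivation_def)
  have "D \<in> twisted_derivations integers \<sigma> \<tau>"
    unfolding twisted_derivations_def
  proof (intro CollectI conjI ballI allI impI)
    show "D \<in> integers \<rightarrow> integers"
      using a by (auto simp: D intro!: integers_mult integers_diff endo_mem)
    show "D x = 0" if "x \<notin> integers" for x
      using that by (simp add: D_def inner_derivation_def)
    fix x assume x: "x \<in> integers"
    show "D (of_int n * x) = of_int n * D x" for n
      using x by (simp add: D integers_of_int_mult endo_scale right_diff_distrib mult.left_commute)
    fix z assume z: "z \<in> integers"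
    show "D (x + z) = D x + D z"
      unfolding D[OF x] D[OF z] D[OF integers_add[OF x z]] endo_add[OF x z]
      by (simp add: algebra_simps)
    show "D (x * z) = D x * \<tau> z + \<sigma> x * D z"
      unfolding D[OF x] D[OF z] D[OF integers_mult[OF x z]] endo_mult[OF x z]
      by (simp add: algebra_simps)
  qed
  then show ?thesis
    by (simp only: D_def)
qed

lemma subspace_derivations: "int_fun.subspace (twisted_derivations integers \<sigma> \<tau>)"
  using integers_of_int[of 0] integers_add integers_of_int_mult
  by (intro subspace_twisted_derivations) auto

lemma derivation_eq_0_if_vanishes:
  assumes D: "D \<in> twisted_derivations integers \<sigma> \<tau>" "D y = 0"
  shows "D = 0"
proof
  fix x
  show "D x = 0 x"
  proof (cases "x \<in> integers")
    case True
    then have "D x * (\<tau> y - \<sigma> y) = 0"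
      using twisted_derivation_cross_mult[OF D(1) True y(1)] D(2) by simp
    with y(2) show ?thesis by simp
  next
    case False
    with D(1) show ?thesis by (simp add: twisted_derivations_def)
  qed
qed

text \<open>Evaluation at \<open>y\<close> followed by the integer coordinates meets the hypotheses
  of the two abstract statements on subgroups of Z^n, with n = p - 1.\<close>

lemma derivation_coordinates:
  defines "\<phi> \<equiv> \<lambda>D. integral_coord (D y)"
  shows "D \<in> twisted_derivations integers \<sigma> \<tau> \<Longrightarrow> E \<in> twisted_derivations integers \<sigma> \<tau> \<Longrightarrow>
      \<phi> (D + E) i = \<phi> D i + \<phi> E i"
    and "D \<in> twisted_derivations integers \<sigma> \<tau> \<Longrightarrow> \<phi> (int_scale c D) i = c * \<phi> D i"
    and "D \<in> twisted_derivations integers \<sigma> \<tau> \<Longrightarrow> (\<And>i. i < p - 1 \<Longrightarrow> \<phi> D i = 0) \<Longrightarrow> D = 0"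
proof -
  have mem: "D y \<in> integers" if "D \<in> twisted_derivations integers \<sigma> \<tau>" for D
    using that y(1) by (auto simp: twisted_derivations_def)
  show "\<phi> (D + E) i = \<phi> D i + \<phi> E i"
    if "D \<in> twisted_derivations integers \<sigma> \<tau>" "E \<in> twisted_derivations integers \<sigma> \<tau>"
    using that by (simp add: \<phi>_def integral_coord_add mem)
  show "\<phi> (int_scale c D) i = c * \<phi> D i" if "D \<in> twisted_derivations integers \<sigma> \<tau>"
    using that by (simp add: \<phi>_def int_scale_def integral_coord_of_int_mult mem)
  show "D = 0" if "D \<in> twisted_derivations integers \<sigma> \<tau>" "\<And>i. i < p - 1 \<Longrightarrow> \<phi> D i = 0"
    using that by (intro derivation_eq_0_if_vanishes integral_coord_eq_0D mem) (auto simp: \<phi>_def)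
qed

lemma finitely_generated_derivations:
  "int_fun.finitely_generated (twisted_derivations integers \<sigma> \<tau>)"
  by (rule derivations.finitely_generated_if_coordinates[where \<phi> = "\<lambda>D. integral_coord (D y)" and n = "p - 1"])
    (fact subspace_derivations derivation_coordinates)+

text \<open>Evaluation at \<open>y\<close> turns \<open>d i\<close> into \<zeta>^i times the fixed
  nonzero factor \<open>\<tau> y - \<sigma> y\<close>, so relations reduce to those between powers
  of \<zeta>. Injectivity is a separate claim because independence of a set does not see
  repetitions, while the rank counts elements.\<close>

lemma independent_inner_derivations:
  defines "d \<equiv> \<lambda>i. inner_derivation integers \<sigma> \<tau> (\<zeta> ^ i)"
  shows "inj_on d {..<p - 1}" and "int_fun.independent (d ` {..<p - 1})"
proof -
  have d_y: "d i y = \<zeta> ^ i * (\<tau> y - \<sigma> y)" for i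
    using y(1) by (simp add: d_def inner_derivation_def)
  show inj: "inj_on d {..<p - 1}"
  proof (rule inj_onI, rule ccontr)
    fix i j assume ij: "i \<in> {..<p - 1}" "j \<in> {..<p - 1}" "d i = d j" "i \<noteq> j"
    have "\<zeta> ^ i = \<zeta> ^ j"
      using d_y[of i] d_y[of j] ij(3) y(2) by simp
    \<comment> \<open>The coefficients of the impossible relation \<zeta>^i - \<zeta>^j = 0.\<close>
    define u :: "nat \<Rightarrow> int" where "u k = (if k = i then 1 else if k = j then - 1 else 0)" for k
    have "(\<Sum>k<p - 1. of_int (u k) * \<zeta> ^ k) = (\<Sum>k\<in>{i, j}. of_int (u k) * \<zeta> ^ k)"
      using ij by (intro sum.mono_neutral_right) (auto simp: u_def)
    also have "\<dots> = 0"
      using ij(4) \<open>\<zeta> ^ i = \<zeta> ^ j\<close> by (simp add: u_def)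
    finally have "u i = 0"
      using ij(1) by (intro int_combination_eq_0) auto
    then show False by (simp add: u_def)
  qed
  show "int_fun.independent (d ` {..<p - 1})"
    unfolding int_fun.dependent_finite[OF finite_imageI[OF finite_lessThan]]
  proof safe
    fix u i
    assume sum: "(\<Sum>D\<in>d ` {..<p - 1}. int_scale (u D) D) = 0" and i: "i < p - 1" "u (d i) \<noteq> 0"
    have sum_apply: "(\<Sum>i\<in>I. f i) y = (\<Sum>i\<in>I. f i y)" for I and f :: "nat \<Rightarrow> 'a \<Rightarrow> 'a"
      by (induction I rule: infinite_finite_induct) simp_all
    have eq: "(\<Sum>i<p - 1. int_scale (u (d i)) (d i)) = 0"
      using sum by (simp only: sum.reindex[OF inj] o_def)
    have "0 = (\<Sum>i<p - 1. int_scale (u (d i)) (d i) y)"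
      using fun_cong[OF eq, of y] by (simp only: sum_apply zero_fun_apply)
    also have "\<dots> = (\<Sum>i<p - 1. of_int (u (d i)) * \<zeta> ^ i) * (\<tau> y - \<sigma> y)"
      by (simp add: int_scale_def d_y sum_distrib_right mult.assoc)
    finally have "(\<Sum>i<p - 1. of_int (u (d i)) * \<zeta> ^ i) = 0"
      using y(2) by simp
    then have "u (d i) = 0"
      using int_combination_eq_0[of "\<lambda>i. u (d i)"] i(1) by simp
    with i(2) show False by simp
  qed
qed

lemma has_rank_derivations:
  "int_fun.has_rank (twisted_derivations integers \<sigma> \<tau>) (p - 1)"
  unfolding int_fun.has_rank_def
proof (intro conjI exI allI impI)
  let ?B = "(\<lambda>i. inner_derivation integers \<sigma> \<tau> (\<zeta> ^ i)) ` {..<p - 1}"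
  show "?B \<subseteq> twisted_derivations integers \<sigma> \<tau>"
    using inner_derivation_in_twisted_derivations integers_power_root by blast
  show "int_fun.independent ?B" and "card ?B = p - 1"
    using independent_inner_derivations by (simp_all add: card_image)
next
  fix B assume "B \<subseteq> twisted_derivations integers \<sigma> \<tau>" "int_fun.independent B"
  note B = this
  have "finite B \<and> card B \<le> p - 1"
    by (rule derivations.card_independent_le_if_coordinates[where \<phi> = "\<lambda>D. integral_coord (D y)"])
      (fact subspace_derivations derivation_coordinates B)+
  then show "finite B" "card B \<le> p - 1" by auto
qed simp

end

end

theorem corollary3p9:
  fixes p :: nat and \<zeta> :: complex and K O\<^sub>K :: "complex set" and \<sigma> \<tau> :: "complex \<Rightarrow> complex"
  assumes "prime p" and "odd p"
    and "primitive_root_of_unity p \<zeta>"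
    and "K = rat_adjoin \<zeta>"
    and "O\<^sub>K = ring_of_integers K"
    and "ring_endo_on O\<^sub>K \<sigma>" and "\<exists>x\<in>O\<^sub>K. \<sigma> x \<noteq> 0"
    and "ring_endo_on O\<^sub>K \<tau>" and "\<exists>x\<in>O\<^sub>K. \<tau> x \<noteq> 0"
    and "\<exists>x\<in>O\<^sub>K. \<sigma> x \<noteq> \<tau> x"
  shows "int_fun.finitely_generated (twisted_derivations O\<^sub>K \<sigma> \<tau>) \<and>
         int_fun.has_rank (twisted_derivations O\<^sub>K \<sigma> \<tau>) (p - 1)"
proof -
  interpret prime_root_of_unity p \<zeta>
    using assms(1,3) by unfold_locales
  obtain y where "y \<in> integers" "\<sigma> y \<noteq> \<tau> y"
    using assms by blast
  then show ?thesis
    using finitely_generated_derivations has_rank_derivations assms(4-6,8) by blast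
qed

end
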